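(* Let $p,q,r\in[1,\infty]$ and $A,B,C,D\in\mathcal{P}(\mathbb{R}^n)$ be such that $\frac1p+\frac1q+\frac1r=1$ and, for (almost) every $x\in\mathbb{R}^n$, $\frac{A(x)}{p}+\frac{C(x)}{r}=1$ and $\frac{B(x)}{q}+\frac{D(x)}{r}=1$. If $k\in L^{A(\cdot)}(\mathbb{R}^n)\cap L^{C(\cdot)}(\mathbb{R}^n)$ and $f\in L^{B(\cdot)}(\mathbb{R}^n)\cap L^{D(\cdot)}(\mathbb{R}^n)$, then $$\|k*f\|_{L^r(\mathbb{R}^n)}\le\|k\|_{L^{A(\cdot)}(\mathbb{R}^n)\cap L^{C(\cdot)}(\mathbb{R}^n)}\,\|f\|_{L^{B(\cdot)}(\mathbb{R}^n)\cap L^{D(\cdot)}(\mathbb{R}^n)}.$$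
   Context: $\mathcal{P}(\mathbb{R}^n)$ is the set of measurable functions $p:\mathbb{R}^n\to[1,\infty]$. Convention: $\frac{a}{\infty}=0$ for $a\in[1,\infty]$. The modular is $\varrho_{p(\cdot)}(f)=\int_{\mathbb{R}^n}\omega_{p(x)}(|f(x)|)\,dx$, with $\omega_p(t)=t^p$ if $p<\infty$, and $\omega_\infty(t)=0$ for $t\le1$, $\omega_\infty(t)=\infty$ for $t>1$. $L^{p(\cdot)}(\mathbb{R}^n)$ is the space of measurable $f$ with $\varrho_{p(\cdot)}(\lambda f)<\infty$ for some $\lambda>0$, normed by $\|f\|_{L^{p(\cdot)}}=\inf\{\lambda>0:\varrho_{p(\cdot)}(f/\lambda)\le1\}$. An intersection $X\cap Y$ of normed spaces carries the norm $\|f\|_{X\cap Y}=\max\{\|f\|_X,\|f\|_Y\}$. *)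

theory Defs
  imports "HOL-Analysis.Analysis"
begin

text \<open>
  Exponents live in \<^typ>\<open>ennreal\<close>, where division by infinity always gives 0; in particular
  the quotient of infinity by infinity is 0, which is the convention of variable-exponent theory.
  Measurability is Lebesgue measurability throughout.
\<close>

definition exponents :: "(real ^ 'n \<Rightarrow> ennreal) set" where
  "exponents = {p \<in> borel_measurable lebesgue. \<forall>x. 1 \<le> p x}"

definition omega :: "ennreal \<Rightarrow> real \<Rightarrow> ennreal" where
  "omega p t = (if p = \<infinity> then (if t \<le> 1 then 0 else \<infinity>) else ennreal (t powr enn2real p))"

definition modular :: "(real ^ 'n \<Rightarrow> ennreal) \<Rightarrow> (real ^ 'n \<Rightarrow> 'a::real_normed_vector) \<Rightarrow> ennreal" where
  "modular p f = (\<integral>\<^sup>+ x. omega (p x) (norm (f x)) \<partial>lebesgue)"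

definition Lvar :: "(real ^ 'n \<Rightarrow> ennreal) \<Rightarrow> (real ^ 'n \<Rightarrow> 'a::real_normed_vector) set" where
  "Lvar p = {f \<in> borel_measurable lebesgue. \<exists>l>0. modular p (\<lambda>x. l *\<^sub>R f x) < \<infinity>}"

text \<open>The infimum is taken in the reals, so this is only meaningful for members of \<^term>\<open>Lvar p\<close>.\<close>

definition Lvar_norm :: "(real ^ 'n \<Rightarrow> ennreal) \<Rightarrow> (real ^ 'n \<Rightarrow> 'a::real_normed_vector) \<Rightarrow> real" where
  "Lvar_norm p f = Inf {l. l > 0 \<and> modular p (\<lambda>x. f x /\<^sub>R l) \<le> 1}"

definition Lvar_inter_norm ::
  "(real ^ 'n \<Rightarrow> ennreal) \<Rightarrow> (real ^ 'n \<Rightarrow> ennreal) \<Rightarrow> (real ^ 'n \<Rightarrow> 'a::real_normed_vector) \<Rightarrow> real" where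
  "Lvar_inter_norm p q f = max (Lvar_norm p f) (Lvar_norm q f)"

text \<open>The classical Lebesgue spaces are those with constant exponent.\<close>

abbreviation Lconst :: "ennreal \<Rightarrow> (real ^ 'n \<Rightarrow> 'a::real_normed_vector) set" where
  "Lconst r \<equiv> Lvar (\<lambda>_. r)"

abbreviation Lconst_norm :: "ennreal \<Rightarrow> (real ^ 'n \<Rightarrow> 'a::real_normed_vector) \<Rightarrow> real" where
  "Lconst_norm r \<equiv> Lvar_norm (\<lambda>_. r)"

text \<open>
  The Bochner integral is 0 where the integrand is not integrable, so statements about the
  convolution should also assert integrability of the integrand for almost every \<open>x\<close>.
\<close>

definition convol ::
  "(real ^ 'n \<Rightarrow> 'a) \<Rightarrow> (real ^ 'n \<Rightarrow> 'a) \<Rightarrow> real ^ 'n \<Rightarrow> 'a::{real_normed_field, euclidean_space}" where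
  "convol k f x = (LINT y|lebesgue. k (x - y) * f y)"

end

theory Submission
  imports Defs
begin

text \<open>
  Young's inequality with variable exponents. Since $A/p + C/r = 1$, we have
  $|k| = (|k|^A)^{1/p} (|k|^C)^{1/r}$, and likewise $|f| = (|f|^B)^{1/q} (|f|^D)^{1/r}$. After
  normalising $k$ and $f$, Hoelder's inequality with exponents $p, q, r$ bounds
  $\int |k(x - y) f(y)|\,dy$ by $w(x)^{1/r}$, where $w = |k|^C * |f|^D$ has integral at most 1 by
  Tonelli. With the convention $u^{1/\infty} = 1$ (also for $u = 0$) no case distinction on infinite
  exponents is needed. Hoelder's inequality is applied as weighted AM-GM under the integral sign.
\<close>

section \<open>Powers with the convention that the zeroth power is 1, and weighted AM-GM\<close>

text \<open>In contrast to \<^term>\<open>u powr 0\<close>, which is 0 at \<^term>\<open>u = (0::real)\<close>, here the value is 1.\<close>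

definition wpow :: "real \<Rightarrow> real \<Rightarrow> real" where
  "wpow u a = (if a = 0 then 1 else u powr a)"

lemma wpow_nonneg [simp]: "0 \<le> wpow u a"
  by (simp add: wpow_def)

lemma wpow_mult: "0 \<le> u \<Longrightarrow> 0 \<le> v \<Longrightarrow> wpow (u * v) a = wpow u a * wpow v a"
  by (simp add: wpow_def powr_mult)

text \<open>Concavity of the logarithm: each of \<open>ln u\<close>, \<open>ln v\<close>,
  \<open>ln w\<close> lies below the tangent of \<open>ln\<close> at the weighted mean
  \<open>S\<close>. In the weighted sum of the three tangent bounds the linear terms cancel, because
  the weights add up to 1.\<close>

lemma weighted_am_gm_pos:
  fixes a b c u v w :: real
  assumes "0 \<le> a" "0 \<le> b" "0 \<le> c" "a + b + c = 1" "0 < u" "0 < v" "0 < w"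
  shows "u powr a * v powr b * w powr c \<le> a * u + b * v + c * w"
proof -
  define S where "S = a * u + b * v + c * w"
  have "0 < S"
  proof -
    have "0 \<le> a * u" "0 \<le> b * v" "0 \<le> c * w" using assms by auto
    \<comment> \<open>The weights add up to 1, so at least one of them is positive.\<close>
    moreover have "0 < a * u \<or> 0 < b * v \<or> 0 < c * w"
      using assms by (auto simp: zero_less_mult_iff)
    ultimately show ?thesis unfolding S_def by linarith
  qed
  have tangent: "t * ln z \<le> t * (z / S - 1) + t * ln S" if "0 \<le> t" "0 < z" for t z
  proof -
    have "ln (z / S) \<le> z / S - 1"
      using that \<open>0 < S\<close> by (intro ln_le_minus_one) auto
    then have "ln z \<le> (z / S - 1) + ln S"
      using that \<open>0 < S\<close> by (simp add: ln_div)
    from mult_left_mono[OF this \<open>0 \<le> t\<close>] show ?thesis by (simp add: algebra_simps)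
  qed
  have "a * ln u + b * ln v + c * ln w
      \<le> (a * (u / S - 1) + b * (v / S - 1) + c * (w / S - 1)) + (a + b + c) * ln S"
    unfolding distrib_right using tangent[of a u] tangent[of b v] tangent[of c w] assms by linarith
  also have "a * (u / S - 1) + b * (v / S - 1) + c * (w / S - 1) = (a * u + b * v + c * w) / S - (a + b + c)"
    by (simp add: right_diff_distrib add_divide_distrib)
  finally have "a * ln u + b * ln v + c * ln w \<le> ln S"
    using \<open>a + b + c = 1\<close> \<open>0 < S\<close> by (simp flip: S_def)
  then have "exp (a * ln u + b * ln v + c * ln w) \<le> S"
    using \<open>0 < S\<close> by (metis exp_le_cancel_iff exp_ln)
  then show ?thesis
    using assms by (simp add: S_def powr_def exp_add)
qed

text \<open>Extends the positive case to vanishing bases. A zero base with nonzero weight makes the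
  left side 0; a base with zero weight contributes to neither side.\<close>

lemma weighted_am_gm:
  fixes a b c u v w :: real
  assumes "0 \<le> a" "0 \<le> b" "0 \<le> c" "a + b + c = 1" "0 \<le> u" "0 \<le> v" "0 \<le> w"
  shows "wpow u a * wpow v b * wpow w c \<le> a * u + b * v + c * w"
proof (cases "(u = 0 \<and> a \<noteq> 0) \<or> (v = 0 \<and> b \<noteq> 0) \<or> (w = 0 \<and> c \<noteq> 0)")
  case True
  then have "wpow u a * wpow v b * wpow w c = 0" by (auto simp: wpow_def)
  moreover have "0 \<le> a * u + b * v + c * w" using assms by simp
  ultimately show ?thesis by linarith
next
  case False
  \<comment> \<open>Replacing a base of weight 0 by 1 changes neither side and makes all bases
    positive, so that \<open>powr\<close> and \<open>wpow\<close> agree on them.\<close>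
  define lift where "lift s z = (if s = 0 then 1 else z)" for s z :: real
  have lift: "wpow z s = lift s z powr s" "s * lift s z = s * z" for s z
    by (cases "s = 0"; simp add: wpow_def lift_def)+
  have "0 < lift a u"
    using False assms(5) by (cases "a = 0") (simp_all add: lift_def)
  moreover have "0 < lift b v"
    using False assms(6) by (cases "b = 0") (simp_all add: lift_def)
  moreover have "0 < lift c w"
    using False assms(7) by (cases "c = 0") (simp_all add: lift_def)
  ultimately have "lift a u powr a * lift b v powr b * lift c w powr c
      \<le> a * lift a u + b * lift b v + c * lift c w"
    by (rule weighted_am_gm_pos[OF assms(1-4)])
  then show ?thesis
    unfolding lift .
qed

section \<open>Reflections, translations and Tonelli for Lebesgue measure\<close>

text \<open>The affine change of variables with factor -1, whose Jacobian has absolute value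
  1.\<close>

lemma distr_lborel_reflect:
  fixes x :: "'b::euclidean_space"
  shows "distr lborel borel (\<lambda>y. x - y) = lborel"
  using lborel_affine[of "-1" x] by (simp add: density_1)

lemma AE_lborel_reflect:
  fixes x :: "'b::euclidean_space"
  assumes "AE y in lborel. P y"
  shows "AE y in lborel. P (x - y)"
proof -
  have eq: "distr lborel lborel (\<lambda>y. x - y) = lborel"
    using distr_lborel_reflect[of x] by (metis distr_cong sets_lborel)
  have "AE y in distr lborel lborel (\<lambda>y. x - y). P y"
    unfolding eq by (rule assms)
  then show ?thesis
    by (rule AE_distrD[rotated]) simp
qed

lemma nn_integral_lborel_reflect:
  fixes x :: "'b::euclidean_space"
  assumes [measurable]: "g \<in> borel_measurable borel"
  shows "(\<integral>\<^sup>+ y. g (x - y) \<partial>lborel) = (\<integral>\<^sup>+ y. g y \<partial>lborel)"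
  by (subst distr_lborel_reflect[of x, symmetric]) (simp add: nn_integral_distr)

lemma nn_integral_lborel_shift:
  fixes x :: "'b::euclidean_space"
  assumes [measurable]: "g \<in> borel_measurable borel"
  shows "(\<integral>\<^sup>+ y. g (y - x) \<partial>lborel) = (\<integral>\<^sup>+ y. g y \<partial>lborel)"
  by (subst lborel_distr_plus[of "-x", symmetric]) (simp add: nn_integral_distr)

text \<open>Tonelli swaps the integrals, and translation invariance makes the inner integral of
  \<open>V\<close> independent of \<open>y\<close>.\<close>

lemma nn_integral_convolution:
  fixes V H :: "'b::euclidean_space \<Rightarrow> ennreal"
  assumes [measurable]: "V \<in> borel_measurable borel" "H \<in> borel_measurable borel"
  shows "(\<integral>\<^sup>+ x. \<integral>\<^sup>+ y. V (x - y) * H y \<partial>lborel \<partial>lborel) = (\<integral>\<^sup>+ x. V x \<partial>lborel) * (\<integral>\<^sup>+ x. H x \<partial>lborel)"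
proof -
  have "(\<integral>\<^sup>+ x. \<integral>\<^sup>+ y. V (x - y) * H y \<partial>lborel \<partial>lborel) = (\<integral>\<^sup>+ y. \<integral>\<^sup>+ x. V (x - y) * H y \<partial>lborel \<partial>lborel)"
    by (rule lborel_pair.Fubini') measurable
  also have "\<dots> = (\<integral>\<^sup>+ y. (\<integral>\<^sup>+ x. V x \<partial>lborel) * H y \<partial>lborel)"
    by (simp add: nn_integral_multc nn_integral_lborel_shift)
  also have "\<dots> = (\<integral>\<^sup>+ x. V x \<partial>lborel) * (\<integral>\<^sup>+ x. H x \<partial>lborel)"
    by (rule nn_integral_cmult) simp
  finally show ?thesis .
qed

section \<open>Hoelder's inequality for the convolution at a fixed point\<close>

text \<open>Three-factor Hoelder at a fixed \<open>x\<close>, with \<open>a\<close>,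
  \<open>b\<close>, \<open>c\<close> as reciprocal exponents. The two powers with exponent
  \<open>c\<close> are merged into a power of \<open>V (x - y) * H y\<close>, whose integral over
  \<open>y\<close> is \<open>W\<close>. Dividing this product by \<open>W\<close> normalises the
  third factor, and AM-GM can then be integrated term by term.\<close>

lemma nn_integral_convolution_le:
  fixes K F U V G H :: "'b::euclidean_space \<Rightarrow> real"
  assumes [measurable]: "U \<in> borel_measurable borel" "V \<in> borel_measurable borel"
      "G \<in> borel_measurable borel" "H \<in> borel_measurable borel"
    and nonneg: "\<And>x. 0 \<le> U x" "\<And>x. 0 \<le> V x" "\<And>x. 0 \<le> G x" "\<And>x. 0 \<le> H x"
      "\<And>x. 0 \<le> K x" "\<And>x. 0 \<le> F x"
    and U: "(\<integral>\<^sup>+ x. U x \<partial>lborel) \<le> 1" and G: "(\<integral>\<^sup>+ x. G x \<partial>lborel) \<le> 1"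
    and abc: "0 \<le> a" "0 \<le> b" "0 \<le> c" "a + b + c = 1"
    and K: "AE x in lborel. K x \<le> wpow (U x) a * wpow (V x) c"
    and F: "AE x in lborel. F x \<le> wpow (G x) b * wpow (H x) c"
    and W: "(\<integral>\<^sup>+ y. V (x - y) * H y \<partial>lborel) = ennreal W" "0 \<le> W"
  shows "(\<integral>\<^sup>+ y. K (x - y) * F y \<partial>lborel) \<le> ennreal (wpow W c)"
proof -
  have KF: "AE y in lborel. K (x - y) * F y \<le> wpow (U (x - y)) a * wpow (G y) b * wpow (V (x - y) * H y) c"
    using AE_lborel_reflect[OF K, of x] F
  proof eventually_elim
    case (elim y)
    then have "K (x - y) * F y \<le> (wpow (U (x - y)) a * wpow (V (x - y)) c) * (wpow (G y) b * wpow (H y) c)"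
      by (intro mult_mono) (auto simp: nonneg)
    then show ?case by (simp add: wpow_mult nonneg mult_ac)
  qed
  show ?thesis
  \<comment> \<open>Division by \<open>W\<close> fails when \<open>W = 0\<close>. If also
    \<open>c \<noteq> 0\<close>, the third factor vanishes for almost every \<open>y\<close>, and so
    does the integrand.\<close>
  proof (cases "W = 0 \<and> c \<noteq> 0")
    case True
    then have "AE y in lborel. ennreal (V (x - y) * H y) = 0"
      using W by (subst nn_integral_0_iff_AE[symmetric]) auto
    with KF have "AE y in lborel. ennreal (K (x - y) * F y) = 0"
    proof eventually_elim
      case (elim y)
      then have "V (x - y) * H y = 0"
        using nonneg[of "x - y"] nonneg[of y]
        by (metis ennreal_eq_0_iff antisym mult_nonneg_nonneg)
      with elim(1) True have "K (x - y) * F y \<le> 0"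
        by (simp add: wpow_def)
      then show ?case by (simp add: ennreal_eq_0_iff)
    qed
    then have "(\<integral>\<^sup>+ y. K (x - y) * F y \<partial>lborel) = (\<integral>\<^sup>+ y. 0 \<partial>(lborel :: 'b measure))"
      by (rule nn_integral_cong_AE)
    then show ?thesis by simp
  next
    case False
    \<comment> \<open>The normalising constant is \<open>W\<close>, except that 1 is taken when
      \<open>c = 0\<close>: the third factor is then the constant 1 and \<open>W\<close> may be 0.
      In both cases \<open>c / s * W = c\<close>.\<close>
    define s where "s = (if c = 0 then 1 else W)"
    have s: "0 < s" "wpow W c = wpow s c" "c / s * W = c"
      using False W(2) by (auto simp: s_def wpow_def)
    \<comment> \<open>AM-GM after pulling \<open>wpow s c\<close> out of the third factor. The
      bracket integrates to at most \<open>a + b + c = 1\<close>.\<close>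
    have "AE y in lborel. K (x - y) * F y \<le> wpow s c * (a * U (x - y) + b * G y + c / s * (V (x - y) * H y))"
      using KF
    proof eventually_elim
      case (elim y)
      have "wpow (V (x - y) * H y) c = wpow s c * wpow (V (x - y) * H y / s) c"
        using s(1) nonneg by (subst wpow_mult[symmetric]) auto
      moreover have "wpow (U (x - y)) a * wpow (G y) b * wpow (V (x - y) * H y / s) c
          \<le> a * U (x - y) + b * G y + c * (V (x - y) * H y / s)"
        using nonneg s(1) by (intro weighted_am_gm abc) auto
      from mult_left_mono[OF this wpow_nonneg[of s c]]
      have "wpow s c * (wpow (U (x - y)) a * wpow (G y) b * wpow (V (x - y) * H y / s) c)
          \<le> wpow s c * (a * U (x - y) + b * G y + c * (V (x - y) * H y / s))" .
      ultimately show ?case using elim by (simp add: mult_ac)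
    qed
    then have "(\<integral>\<^sup>+ y. K (x - y) * F y \<partial>lborel)
        \<le> (\<integral>\<^sup>+ y. ennreal (wpow s c) * (ennreal a * U (x - y) + ennreal b * G y
            + ennreal (c / s) * (V (x - y) * H y)) \<partial>lborel)"
    proof (intro nn_integral_mono_AE, eventually_elim)
      case (elim y)
      have "ennreal (wpow s c) * (ennreal a * U (x - y) + ennreal b * G y + ennreal (c / s) * (V (x - y) * H y))
          = ennreal (wpow s c * (a * U (x - y) + b * G y + c / s * (V (x - y) * H y)))"
        using s(1) by (simp add: nonneg abc ennreal_mult'[symmetric] ennreal_plus[symmetric] del: ennreal_plus)
      with elim show ?case by (simp only: ennreal_leI)
    qed
    also have "\<dots> = ennreal (wpow s c) * (ennreal a * (\<integral>\<^sup>+ y. U (x - y) \<partial>lborel) + ennreal b * (\<integral>\<^sup>+ y. G y \<partial>lborel)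
            + ennreal (c / s) * (\<integral>\<^sup>+ y. V (x - y) * H y \<partial>lborel))"
      by (simp add: nn_integral_cmult nn_integral_add)
    also have "\<dots> \<le> ennreal (wpow s c) * (ennreal a * 1 + ennreal b * 1 + ennreal (c / s) * ennreal W)"
      using U G by (intro mult_left_mono add_mono)
        (auto simp: W nn_integral_lborel_reflect[where g = "\<lambda>x. ennreal (U x)"])
    also have "\<dots> = ennreal (wpow s c)"
      using abc s W(2) by (simp add: ennreal_mult'[symmetric] ennreal_plus[symmetric] del: ennreal_plus)
    finally show ?thesis by (simp add: s)
  qed
qed

section \<open>Factorisation of a modulus into powers of the modular integrands\<close>

text \<open>For \<open>p = \<infinity>\<close> both sides are 1, whatever \<open>omega A t\<close>
  is. For finite \<open>p\<close>, finiteness of \<open>A / p\<close> forces \<open>A\<close> to be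
  finite, so \<open>omega\<close> is an ordinary power and the exponents multiply.\<close>

lemma wpow_omega:
  assumes "0 < t" "1 \<le> A" "1 \<le> p" "A / p \<noteq> \<infinity>"
  shows "wpow (enn2real (omega A t)) (enn2real (1 / p)) = t powr enn2real (A / p)"
proof (cases "p = \<infinity>")
  case True
  then show ?thesis using assms by (simp add: wpow_def)
next
  case False
  with assms have "A \<noteq> \<infinity>" by (auto simp: ennreal_top_divide)
  moreover have "enn2real (A / p) = enn2real A * enn2real (1 / p)"
    by (simp add: divide_ennreal_def enn2real_mult)
  moreover have "enn2real (1 / p) \<noteq> 0"
    using False assms by (cases p) (auto simp: enn2real_eq_0_iff divide_ennreal_def ennreal_inverse_positive)
  ultimately show ?thesis
    using assms by (simp add: omega_def wpow_def powr_powr)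
qed

text \<open>For \<open>t > 0\<close> the product equals \<open>t\<close> raised to
  \<open>A / p + C / r = 1\<close>. An infinite value of \<open>omega\<close>, which
  \<open>enn2real\<close> sends to 0, does no harm: an infinite \<open>A\<close> forces
  \<open>p = \<infinity>\<close>, so that value only occurs with exponent 0, and the same holds for
  \<open>C\<close> and \<open>r\<close>.\<close>

lemma le_wpow_omega:
  assumes "0 \<le> t" "1 \<le> A" "1 \<le> C" "1 \<le> p" "1 \<le> r" "A / p + C / r = 1"
  shows "t \<le> wpow (enn2real (omega A t)) (enn2real (1 / p)) * wpow (enn2real (omega C t)) (enn2real (1 / r))"
proof (cases "t = 0")
  case False
  have fin: "A / p \<noteq> \<infinity>" "C / r \<noteq> \<infinity>" using assms(6) by auto
  then have "enn2real (A / p) + enn2real (C / r) = 1"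
    using assms(6) by (simp add: enn2real_plus[symmetric] less_top)
  then show ?thesis
    using False assms fin by (simp add: wpow_omega powr_add[symmetric])
qed (simp add: assms)

section \<open>Borel representatives of Lebesgue measurable functions\<close>

text \<open>The real-valued case is applied to each coordinate, and the finitely many
  representatives are reassembled along the basis.\<close>

lemma completion_ex_borel_measurable_euclidean:
  fixes g :: "'b \<Rightarrow> 'a::euclidean_space"
  assumes "g \<in> borel_measurable (completion M)"
  obtains g' where "g' \<in> borel_measurable M" "AE x in M. g x = g' x"
proof -
  have "\<exists>h. h \<in> borel_measurable M \<and> (AE x in M. g x \<bullet> b = h x)" for b
    using completion_ex_borel_measurable_real[of "\<lambda>x. g x \<bullet> b" M] assms by auto
  then obtain h where h: "\<And>b. h b \<in> borel_measurable M" "\<And>b. AE x in M. g x \<bullet> b = h b x"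
    by metis
  have "AE x in M. \<forall>b\<in>Basis. g x \<bullet> b = h b x"
    by (intro AE_finite_allI h) simp
  then have "AE x in M. g x = (\<Sum>b\<in>Basis. h b x *\<^sub>R b)"
  proof eventually_elim
    case (elim x)
    then show ?case by (subst euclidean_representation[of "g x", symmetric]) simp
  qed
  with h(1) show thesis by (intro that) auto
qed

text \<open>A finite integral makes the function finite almost everywhere, so passing to real values
  by \<open>enn2real\<close> does not change the integral.\<close>

lemma completion_ex_borel_measurable_bounded_integral:
  fixes g :: "'b \<Rightarrow> ennreal"
  assumes "g \<in> borel_measurable (completion M)" "(\<integral>\<^sup>+ x. g x \<partial>completion M) < \<infinity>"
  obtains h :: "'b \<Rightarrow> real" where "h \<in> borel_measurable M" "\<And>x. 0 \<le> h x" "AE x in M. h x = enn2real (g x)"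
    "(\<integral>\<^sup>+ x. h x \<partial>M) = (\<integral>\<^sup>+ x. g x \<partial>completion M)"
proof -
  obtain g' where [measurable]: "g' \<in> borel_measurable M" and eq: "AE x in M. g x = g' x"
    using completion_ex_borel_measurable[OF assms(1)] by auto
  have int: "(\<integral>\<^sup>+ x. g' x \<partial>M) = (\<integral>\<^sup>+ x. g x \<partial>completion M)"
    unfolding nn_integral_completion using eq by (intro nn_integral_cong_AE) auto
  with assms have "AE x in M. g' x \<noteq> \<infinity>"
    by (intro nn_integral_PInf_AE) auto
  then have "(\<integral>\<^sup>+ x. enn2real (g' x) \<partial>M) = (\<integral>\<^sup>+ x. g' x \<partial>M)"
    by (intro nn_integral_cong_AE) (auto simp: less_top)
  with eq int show thesis by (intro that[of "\<lambda>x. enn2real (g' x)"]) auto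
qed

lemma measurable_lebesgue_reflect:
  fixes x :: "'b::euclidean_space"
  shows "(\<lambda>y. x - y) \<in> lebesgue \<rightarrow>\<^sub>M lebesgue"
  using lebesgue_affine_measurable[of "\<lambda>_. -1" x]
  by (simp add: sum_negf euclidean_representation)

lemma borel_measurable_omega:
  assumes [measurable]: "p \<in> borel_measurable M" "t \<in> borel_measurable M"
  shows "(\<lambda>x. omega (p x) (t x)) \<in> borel_measurable M"
  unfolding omega_def by measurable

lemma omega_mono: "0 \<le> s \<Longrightarrow> s \<le> t \<Longrightarrow> omega p s \<le> omega p t"
  by (auto simp: omega_def intro!: ennreal_leI powr_mono2)

text \<open>For finite \<open>p\<close> this is \<open>s \<le> s powr p\<close>, as both are at
  least 1. For \<open>p = \<infinity>\<close> either both sides vanish or the right side is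
  infinite. It serves to scale a finite modular down to at most 1.\<close>

lemma omega_divide_le:
  assumes "1 \<le> p" "1 \<le> s" "0 \<le> t"
  shows "omega p (t / s) \<le> ennreal (1 / s) * omega p t"
proof (cases "p = \<infinity>")
  case True
  show ?thesis
  proof (cases "t \<le> 1")
    case t: True
    with assms have "t / s \<le> 1" by (simp add: divide_le_eq)
    with True t show ?thesis by (simp add: omega_def)
  next
    case False
    with True assms show ?thesis by (simp add: omega_def ennreal_mult_top)
  qed
next
  case False
  have "1 \<le> enn2real p"
    using enn2real_mono[OF assms(1)] False by (simp add: less_top)
  then have "s powr 1 \<le> s powr enn2real p"
    using assms by (intro powr_mono) auto
  then have "t powr enn2real p / s powr enn2real p \<le> t powr enn2real p / s"
    using assms by (intro divide_left_mono) (auto intro!: mult_pos_pos)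
  with False assms show ?thesis
    by (simp add: omega_def powr_divide ennreal_mult'[symmetric] ennreal_leI)
qed

text \<open>A finite modular \<open>m\<close> of \<open>l *\<^sub>R f\<close> drops to at most
  \<open>m / s \<le> 1\<close> after a further division by \<open>s = max 1 m\<close>. Hence the
  infimum defining the norm is taken over a nonempty set.\<close>

lemma Lvar_norm_set_nonempty:
  assumes p: "p \<in> exponents" and f: "f \<in> Lvar p"
  shows "\<exists>l>0. modular p (\<lambda>x. f x /\<^sub>R l) \<le> 1"
proof -
  from f obtain l where l: "l > 0" "modular p (\<lambda>x. l *\<^sub>R f x) < \<infinity>"
    and [measurable]: "f \<in> borel_measurable lebesgue" by (auto simp: Lvar_def)
  from p have [measurable]: "p \<in> borel_measurable lebesgue" and p1: "\<And>x. 1 \<le> p x"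
    by (auto simp: exponents_def)
  define m where "m = enn2real (modular p (\<lambda>x. l *\<^sub>R f x))"
  have m: "modular p (\<lambda>x. l *\<^sub>R f x) = ennreal m" "0 \<le> m"
    using l by (auto simp: m_def)
  define s where "s = max 1 m"
  have s: "1 \<le> s" "m \<le> s" by (auto simp: s_def)
  have "modular p (\<lambda>x. f x /\<^sub>R (s / l)) = (\<integral>\<^sup>+ x. omega (p x) (norm (l *\<^sub>R f x) / s) \<partial>lebesgue)"
    using l s by (simp add: modular_def divide_inverse mult_ac)
  also have "\<dots> \<le> (\<integral>\<^sup>+ x. ennreal (1 / s) * omega (p x) (norm (l *\<^sub>R f x)) \<partial>lebesgue)"
    using s by (intro nn_integral_mono omega_divide_le p1) auto
  also have "\<dots> = ennreal (1 / s) * ennreal m"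
    unfolding m(1)[symmetric] modular_def by (intro nn_integral_cmult borel_measurable_omega) measurable
  also have "\<dots> \<le> 1"
    using s m by (simp add: ennreal_mult'[symmetric] divide_le_eq)
  finally show ?thesis using l s by (intro exI[of _ "s / l"]) auto
qed

text \<open>Some admissible \<open>s\<close> lies below \<open>l\<close>, and the modular decreases
  as the divisor grows. The strict inequality avoids the question whether the infimum is
  attained.\<close>

lemma modular_le_1_if_Lvar_norm_less:
  assumes p: "p \<in> exponents" and f: "f \<in> Lvar p" and l: "Lvar_norm p f < l"
  shows "0 < l \<and> modular p (\<lambda>x. f x /\<^sub>R l) \<le> 1"
proof -
  let ?S = "{l. l > 0 \<and> modular p (\<lambda>x. f x /\<^sub>R l) \<le> 1}"
  have "?S \<noteq> {}" using Lvar_norm_set_nonempty[OF p f] by auto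
  then obtain s where s: "0 < s" "modular p (\<lambda>x. f x /\<^sub>R s) \<le> 1" "s < l"
    using cInf_lessD[of ?S l] l by (auto simp: Lvar_norm_def)
  have "modular p (\<lambda>x. f x /\<^sub>R l) \<le> modular p (\<lambda>x. f x /\<^sub>R s)"
    unfolding modular_def using s
    by (intro nn_integral_mono omega_mono) (auto intro!: mult_right_mono le_imp_inverse_le)
  with s show ?thesis by auto
qed

lemma Lvar_norm_le:
  assumes "0 < l" "modular p (\<lambda>x. f x /\<^sub>R l) \<le> 1"
  shows "Lvar_norm p f \<le> l"
  unfolding Lvar_norm_def using assms by (intro cInf_lower bdd_belowI[of _ 0]) auto

lemma Lvar_norm_nonneg:
  assumes "p \<in> exponents" "f \<in> Lvar p"
  shows "0 \<le> Lvar_norm p f"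
  using Lvar_norm_set_nonempty[OF assms] unfolding Lvar_norm_def by (intro cInf_greatest) auto

section \<open>The inequality for normalised functions\<close>

text \<open>Turns the pointwise Hoelder bound into a bound on the modular integrand. For
  \<open>r = \<infinity>\<close> the hypothesis reads \<open>t \<le> 1\<close>, which is exactly
  where \<open>omega\<close> is 0.\<close>

lemma omega_wpow_le:
  assumes r: "1 \<le> r" and t: "0 \<le> t" "t \<le> wpow W (enn2real (1 / r))" and W: "0 \<le> W"
  shows "omega r t \<le> ennreal W"
proof (cases "r = \<infinity>")
  case True
  with t show ?thesis by (simp add: omega_def wpow_def)
next
  case False
  have "enn2real r \<noteq> 0" using False r by (auto simp: enn2real_eq_0_iff)
  moreover have "enn2real (1 / r) = 1 / enn2real r"
    using False r by (cases r) (auto simp: divide_ennreal ennreal_1[symmetric] simp del: ennreal_1)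
  ultimately have "t \<le> W powr (1 / enn2real r)" "0 < enn2real r"
    using t by (auto simp: wpow_def less_le)
  then have "t powr enn2real r \<le> (W powr (1 / enn2real r)) powr enn2real r"
    using t by (intro powr_mono2) auto
  also have "\<dots> = W" using W \<open>0 < enn2real r\<close> by (simp add: powr_powr)
  finally show ?thesis using False by (simp add: omega_def ennreal_leI)
qed

lemma convol_normalized:
  fixes p q r :: ennreal
    and A B C D :: "real ^ 'n \<Rightarrow> ennreal"
    and k f :: "real ^ 'n \<Rightarrow> 'a::{real_normed_field, euclidean_space}"
  assumes pqr: "1 \<le> p" "1 \<le> q" "1 \<le> r"
    and exps: "A \<in> exponents" "B \<in> exponents" "C \<in> exponents" "D \<in> exponents"
    and sum1: "1 / p + 1 / q + 1 / r = 1"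
    and AC: "AE x in lebesgue. A x / p + C x / r = 1"
    and BD: "AE x in lebesgue. B x / q + D x / r = 1"
    and k: "k \<in> borel_measurable lebesgue" "modular A k \<le> 1" "modular C k \<le> 1"
    and f: "f \<in> borel_measurable lebesgue" "modular B f \<le> 1" "modular D f \<le> 1"
  shows "AE x in lebesgue. integrable lebesgue (\<lambda>y. k (x - y) * f y)"
    and "convol k f \<in> borel_measurable lebesgue"
    and "modular (\<lambda>_. r) (convol k f) \<le> 1"
proof -
  define a b c where "a = enn2real (1 / p)" and "b = enn2real (1 / q)" and "c = enn2real (1 / r)"
  have abc: "0 \<le> a" "0 \<le> b" "0 \<le> c" "a + b + c = 1"
  proof -
    have "1 / p \<noteq> top" "1 / q \<noteq> top" "1 / r \<noteq> top" using sum1 by auto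
    then have "a + b + c = enn2real (1 / p + 1 / q + 1 / r)"
      unfolding a_def b_def c_def by (simp add: enn2real_plus less_top)
    with sum1 show "a + b + c = 1" by simp
  qed (auto simp: a_def b_def c_def)
  obtain k' where [measurable]: "k' \<in> borel_measurable lborel" and k': "AE x in lborel. k x = k' x"
    using completion_ex_borel_measurable_euclidean[OF k(1)] .
  obtain f' where [measurable]: "f' \<in> borel_measurable lborel" and f': "AE x in lborel. f x = f' x"
    using completion_ex_borel_measurable_euclidean[OF f(1)] .
  \<comment> \<open>Each modular integrand gets a real-valued nonnegative Borel version, so that
    Tonelli on \<open>lborel\<close> applies.\<close>
  have rep: "\<exists>h. h \<in> borel_measurable lborel \<and> (\<forall>x. 0 \<le> h x) \<and> (AE x in lborel. h x = enn2real (omega (E x) (norm (g x))))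
      \<and> (\<integral>\<^sup>+ x. ennreal (h x) \<partial>lborel) \<le> 1"
    if "E \<in> exponents" "g \<in> borel_measurable lebesgue" "modular E g \<le> 1" for E and g :: "real ^ 'n \<Rightarrow> 'a"
  proof -
    have "(\<lambda>x. omega (E x) (norm (g x))) \<in> borel_measurable lebesgue"
      using that by (intro borel_measurable_omega) (auto simp: exponents_def)
    moreover have "(\<integral>\<^sup>+ x. omega (E x) (norm (g x)) \<partial>lebesgue) < \<infinity>"
      using that(3) by (simp add: modular_def order_le_less_trans[of _ 1])
    ultimately obtain h where "h \<in> borel_measurable lborel" "\<And>x. 0 \<le> h x"
      "AE x in lborel. h x = enn2real (omega (E x) (norm (g x)))"
      "(\<integral>\<^sup>+ x. ennreal (h x) \<partial>lborel) = (\<integral>\<^sup>+ x. omega (E x) (norm (g x)) \<partial>lebesgue)"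
      using completion_ex_borel_measurable_bounded_integral by blast
    with that(3) show ?thesis by (auto simp: modular_def)
  qed
  obtain U where U[measurable]: "U \<in> borel_measurable lborel" "\<And>x. 0 \<le> U x"
      "AE x in lborel. U x = enn2real (omega (A x) (norm (k x)))" "(\<integral>\<^sup>+ x. ennreal (U x) \<partial>lborel) \<le> 1"
    using rep[OF exps(1) k(1,2)] by auto
  obtain V where V[measurable]: "V \<in> borel_measurable lborel" "\<And>x. 0 \<le> V x"
      "AE x in lborel. V x = enn2real (omega (C x) (norm (k x)))" "(\<integral>\<^sup>+ x. ennreal (V x) \<partial>lborel) \<le> 1"
    using rep[OF exps(3) k(1,3)] by auto
  obtain G where G[measurable]: "G \<in> borel_measurable lborel" "\<And>x. 0 \<le> G x"
      "AE x in lborel. G x = enn2real (omega (B x) (norm (f x)))" "(\<integral>\<^sup>+ x. ennreal (G x) \<partial>lborel) \<le> 1"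
    using rep[OF exps(2) f(1,2)] by auto
  obtain H where H[measurable]: "H \<in> borel_measurable lborel" "\<And>x. 0 \<le> H x"
      "AE x in lborel. H x = enn2real (omega (D x) (norm (f x)))" "(\<integral>\<^sup>+ x. ennreal (H x) \<partial>lborel) \<le> 1"
    using rep[OF exps(4) f(1,3)] by auto
  have ge1: "1 \<le> A x" "1 \<le> B x" "1 \<le> C x" "1 \<le> D x" for x
    using exps by (auto simp: exponents_def)
  have K: "AE x in lborel. norm (k' x) \<le> wpow (U x) a * wpow (V x) c"
    using k' U(3) V(3) AC[unfolded AE_completion_iff]
    by eventually_elim (auto simp: a_def c_def intro!: le_wpow_omega ge1 pqr)
  have F: "AE x in lborel. norm (f' x) \<le> wpow (G x) b * wpow (H x) c"
    using f' G(3) H(3) BD[unfolded AE_completion_iff]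
    by eventually_elim (auto simp: b_def c_def intro!: le_wpow_omega ge1 pqr)
  define w where "w x = (\<integral>\<^sup>+ y. ennreal (V (x - y) * H y) \<partial>lborel)" for x
  have w[measurable]: "w \<in> borel_measurable lborel"
    unfolding w_def by measurable
  have "(\<integral>\<^sup>+ x. w x \<partial>lborel) = (\<integral>\<^sup>+ x. ennreal (V x) \<partial>lborel) * (\<integral>\<^sup>+ x. ennreal (H x) \<partial>lborel)"
    using nn_integral_convolution[of "\<lambda>x. ennreal (V x)" "\<lambda>x. ennreal (H x)"] V(2) H(2)
    by (simp add: w_def ennreal_mult)
  also have "\<dots> \<le> 1 * 1" by (intro mult_mono V H) auto
  finally have w1: "(\<integral>\<^sup>+ x. w x \<partial>lborel) \<le> 1" by simp
  then have "(\<integral>\<^sup>+ x. w x \<partial>lborel) \<noteq> \<infinity>" by (auto simp: top_unique)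
  then have wfin: "AE x in lborel. w x \<noteq> \<infinity>"
    by (intro nn_integral_PInf_AE) auto
  \<comment> \<open>Finiteness of \<open>w x\<close> makes \<open>enn2real\<close> faithful. The
    bound gives both integrability of the integrand at \<open>x\<close> and the estimate of the
    convolution there.\<close>
  have bound: "(\<integral>\<^sup>+ y. norm (k' (x - y) * f' y) \<partial>lborel) \<le> ennreal (wpow (enn2real (w x)) c)"
    if "w x \<noteq> \<infinity>" for x
    unfolding norm_mult
    using that U V G H K F abc
    by (intro nn_integral_convolution_le[of U V G H]) (auto simp: w_def less_top)
  have eq: "AE y in lborel. k (x - y) * f y = k' (x - y) * f' y" for x
    using AE_lborel_reflect[OF k', of x] f' by eventually_elim simp
  have meas: "(\<lambda>y. k (x - y) * f y) \<in> borel_measurable lebesgue" for x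
    by (intro borel_measurable_times f(1) measurable_compose[OF measurable_lebesgue_reflect k(1)])
  have meas': "(\<lambda>y. k' (x - y) * f' y) \<in> borel_measurable lebesgue" for x
    by (intro measurable_completion) measurable
  have integrable_iff: "integrable lebesgue (\<lambda>y. k (x - y) * f y) \<longleftrightarrow> integrable lborel (\<lambda>y. k' (x - y) * f' y)" for x
    using integrable_cong_AE[OF meas[of x] meas'[of x] AE_completion[OF eq[of x]]]
    by (simp add: integrable_completion)
  \<comment> \<open>This holds at every \<open>x\<close>, since the two integrands agree for almost
    every \<open>y\<close>. The convolution is therefore a parameter integral of a Borel function,
    which yields its measurability.\<close>
  have convol_eq: "convol k f x = (LINT y|lborel. k' (x - y) * f' y)" for x
    unfolding convol_def using integral_cong_AE[OF meas[of x] meas'[of x] AE_completion[OF eq[of x]]]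
    by (simp add: integral_completion)
  have int: "integrable lborel (\<lambda>y. k' (x - y) * f' y)" if "w x \<noteq> \<infinity>" for x
    using bound[OF that] by (intro integrableI_bounded) (auto simp: order_le_less_trans)
  show "AE x in lebesgue. integrable lebesgue (\<lambda>y. k (x - y) * f y)"
    unfolding integrable_iff
    by (intro AE_completion eventually_mono[OF wfin]) (rule int)
  show "convol k f \<in> borel_measurable lebesgue"
    unfolding convol_eq[abs_def] by (intro measurable_completion) measurable
  have "modular (\<lambda>_. r) (convol k f) = (\<integral>\<^sup>+ x. omega r (norm (convol k f x)) \<partial>lborel)"
    by (simp add: modular_def nn_integral_completion)
  also have "\<dots> \<le> (\<integral>\<^sup>+ x. w x \<partial>lborel)"
  proof (intro nn_integral_mono_AE, use wfin in eventually_elim)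
    case (elim x)
    have "ennreal (norm (convol k f x)) \<le> (\<integral>\<^sup>+ y. norm (k' (x - y) * f' y) \<partial>lborel)"
      unfolding convol_eq by (rule integral_norm_bound_ennreal[OF int[OF elim]])
    also note bound[OF elim]
    finally have "omega r (norm (convol k f x)) \<le> ennreal (enn2real (w x))"
      by (intro omega_wpow_le pqr) (auto simp: c_def)
    with elim show ?case by (simp add: less_top)
  qed
  finally show "modular (\<lambda>_. r) (convol k f) \<le> 1" using w1 by simp
qed

section \<open>Removal of the normalisation by scaling\<close>

theorem theorem3p6:
  fixes p q r :: ennreal
    and A B C D :: "real ^ 'n \<Rightarrow> ennreal"
    and k f :: "real ^ 'n \<Rightarrow> 'a::{real_normed_field, euclidean_space}"
  assumes "1 \<le> p" and "1 \<le> q" and "1 \<le> r"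
    and "A \<in> exponents" and "B \<in> exponents" and "C \<in> exponents" and "D \<in> exponents"
    and "1 / p + 1 / q + 1 / r = 1"
    and "AE x in lebesgue. A x / p + C x / r = 1"
    and "AE x in lebesgue. B x / q + D x / r = 1"
    and "k \<in> Lvar A \<inter> Lvar C"
    and "f \<in> Lvar B \<inter> Lvar D"
  shows "(AE x in lebesgue. integrable lebesgue (\<lambda>y. k (x - y) * f y)) \<and>
    convol k f \<in> Lconst r \<and>
    Lconst_norm r (convol k f) \<le> Lvar_inter_norm A C k * Lvar_inter_norm B D f"
proof -
  define N M where "N = Lvar_inter_norm A C k" and "M = Lvar_inter_norm B D f"
  have nonneg: "0 \<le> N" "0 \<le> M"
    using Lvar_norm_nonneg[of A k] Lvar_norm_nonneg[of B f] assms
    by (auto simp: N_def M_def Lvar_inter_norm_def)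
  have [measurable]: "k \<in> borel_measurable lebesgue" "f \<in> borel_measurable lebesgue"
    using assms by (auto simp: Lvar_def)
  \<comment> \<open>Divisors strictly above the norms put all four modulars below 1 and are positive
    even if \<open>N\<close> or \<open>M\<close> is 0.\<close>
  have scaled: "(AE x in lebesgue. integrable lebesgue (\<lambda>y. k (x - y) * f y)) \<and>
      convol k f \<in> borel_measurable lebesgue \<and> modular (\<lambda>_. r) (\<lambda>x. convol k f x /\<^sub>R (l * m)) \<le> 1"
    if lm: "N < l" "M < m" for l m
  proof -
    have pos: "0 < l" "0 < m" using lm nonneg by auto
    have k: "modular A (\<lambda>x. k x /\<^sub>R l) \<le> 1" "modular C (\<lambda>x. k x /\<^sub>R l) \<le> 1"
      using modular_le_1_if_Lvar_norm_less[of A k l] modular_le_1_if_Lvar_norm_less[of C k l] lm assms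
      by (auto simp: N_def Lvar_inter_norm_def)
    have f: "modular B (\<lambda>x. f x /\<^sub>R m) \<le> 1" "modular D (\<lambda>x. f x /\<^sub>R m) \<le> 1"
      using modular_le_1_if_Lvar_norm_less[of B f m] modular_le_1_if_Lvar_norm_less[of D f m] lm assms
      by (auto simp: M_def Lvar_inter_norm_def)
    have mult: "(k (x - y) /\<^sub>R l) * (f y /\<^sub>R m) = (k (x - y) * f y) /\<^sub>R (l * m)" for x y
      by simp
    have conv: "convol (\<lambda>x. k x /\<^sub>R l) (\<lambda>x. f x /\<^sub>R m) = (\<lambda>x. convol k f x /\<^sub>R (l * m))"
      unfolding convol_def mult by simp
    have rescale: "(l * m) *\<^sub>R (z /\<^sub>R (l * m)) = z" for z :: 'a
      using pos by (simp add: field_simps)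
    have "(\<lambda>x. k x /\<^sub>R l) \<in> borel_measurable lebesgue" "(\<lambda>x. f x /\<^sub>R m) \<in> borel_measurable lebesgue"
      by measurable
    note norm = convol_normalized[OF assms(1-10) this(1) k this(2) f]
    have "(\<lambda>x. (l * m) *\<^sub>R (convol k f x /\<^sub>R (l * m))) \<in> borel_measurable lebesgue"
      using norm(2) unfolding conv by (rule borel_measurable_scaleR[OF borel_measurable_const])
    then have "convol k f \<in> borel_measurable lebesgue"
      by (simp only: rescale)
    moreover have "AE x in lebesgue. integrable lebesgue (\<lambda>y. k (x - y) * f y)"
      using norm(1) unfolding mult
    proof eventually_elim
      case (elim x)
      from integrable_scaleR_right[OF this, of "l * m"] show ?case
        by (simp only: rescale)
    qed
    ultimately show ?thesis
      using norm(3) unfolding conv by simp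
  qed
  have upper: "Lconst_norm r (convol k f) \<le> l * m" if "N < l" "M < m" for l m
    using scaled[OF that] that nonneg by (intro Lvar_norm_le) auto
  \<comment> \<open>The bound holds for all \<open>l > N\<close> and \<open>m > M\<close>; with
    \<open>l = N + e\<close> and \<open>m = M + e\<close> it passes to the limit as \<open>e\<close>
    tends to 0 from the right.\<close>
  have "((\<lambda>e. (N + e) * (M + e)) \<longlongrightarrow> (N + 0) * (M + 0)) (at_right 0)"
    by (intro tendsto_intros)
  moreover have "\<forall>\<^sub>F e in at_right 0. Lconst_norm r (convol k f) \<le> (N + e) * (M + e)"
    using eventually_at_right_less by eventually_elim (rule upper; simp)
  ultimately have "Lconst_norm r (convol k f) \<le> N * M"
    using tendsto_lowerbound[of _ _ "at_right 0"] by fastforce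
  moreover have "convol k f \<in> Lconst r"
  proof -
    \<comment> \<open>Any divisors above the norms give a finite modular; \<open>N + 1\<close> and
      \<open>M + 1\<close> are one choice.\<close>
    have "inverse ((N + 1) * (M + 1)) > 0" using nonneg by simp
    moreover have "modular (\<lambda>_. r) (\<lambda>x. inverse ((N + 1) * (M + 1)) *\<^sub>R convol k f x) < \<infinity>"
      using scaled[of "N + 1" "M + 1"] by (auto intro: order_le_less_trans[of _ 1])
    ultimately show ?thesis
      using scaled[of "N + 1" "M + 1"] unfolding Lvar_def by auto
  qed
  moreover have "AE x in lebesgue. integrable lebesgue (\<lambda>y. k (x - y) * f y)"
    using scaled[of "N + 1" "M + 1"] by simp
  ultimately show ?thesis unfolding N_def M_def by blast
qed

end
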